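(* Let $(Y_t,Z_t,K_t)_{0\le t\le T}$ be a solution of the reflected backward stochastic difference equation (RBSDE) with standard data $(\xi,f,S)$. Then for each $t\in\{0,1,\dots,T\}$, $$Y_t=\sup_{\theta\in\mathcal{J}_t}E\Big[\sum_{t\le s<\theta}f(s,Y_s,Z_s)+S_\theta 1_{\{\theta<T\}}+\xi 1_{\{\theta=T\}}\,\Big|\,\mathcal{F}_t\Big]\quad P\text{-a.s.},$$ where $\mathcal{J}_t$ is the set of all $(\mathcal{F}_s)$-stopping times $\theta$ with $t\le\theta\le T$ (the supremum being an essential supremum).
   Context: Setting: $T$ is a positive integer, $m\ge 1$, and $X=(X_t)_{0\le t\le T}$ is a stochastic process with values in the set of standard basis vectors $\{e_1,\dots,e_m\}$ of $\mathbb{R}^m$ on a probability space $(\Omega,\mathcal{F},P)$; $\mathcal{F}_t$ is the completion of $\sigma(X_0,\dots,X_t)$ and $\mathcal{F}=\mathcal{F}_T$. $M_t=X_t-E[X_t\mid\mathcal{F}_{t-1}]$ for $t=1,\dots,T$. $[\cdot]^*$ denotes transposition. Standard data: a triple $(\xi,f,S)$ where $\xi\in L^1(\mathcal{F}_T;\mathbb{R})$; $f:\Omega\times\{0,\dots,T\}\times\mathbb{R}\times\mathbb{R}^m\to\mathbb{R}$ is such that $f(\cdot,y,z)$ is an adapted process for every $(y,z)$; and $S=(S_t)_{0\le t\le T}$ (the obstacle) is a real-valued adapted process with $S_T\le\xi$ $P$-a.s. Solution of the RBSDE with data $(\xi,f,S)$: adapted processes $(Y_t,Z_t,K_t)_{0\le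 t\le T}$ with values in $\mathbb{R}\times\mathbb{R}^m\times\mathbb{R}$ such that for all $0\le t\le T$: (i) $Y_t=\xi+\sum_{t\le u<T}f(u,Y_u,Z_u)+K_T-K_t-\sum_{t\le u<T}Z_u^*M_{u+1}$ $P$-a.s.; (ii) $Y_t,Z_t,K_t$ are integrable; (iii) $Y_t\ge S_t$ $P$-a.s.; (iv) $K$ is increasing (non-decreasing) in $t$, $K_0=0$, and $\sum_{0\le t<T}(Y_t-S_t)(K_{t+1}-K_t)=0$ $P$-a.s. *)

theory Defs
  imports "HOL-Probability.Probability"
begin

text \<open>The \<open>\<sigma>\<close>-algebra \<open>\<F>\<^sub>t\<close>: the measure-theoretic completion of \<open>\<sigma>(X\<^sub>0, \<dots>, X\<^sub>t)\<close>
  with respect to the restriction of \<open>P\<close> to it.\<close>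

definition completed_filtration ::
    "'a measure \<Rightarrow> (nat \<Rightarrow> 'a \<Rightarrow> real ^ 'm) \<Rightarrow> nat \<Rightarrow> 'a measure" where
  "completed_filtration P X t =
     completion (restr_to_subalg P
       (sigma (space P) {X s -` A \<inter> space P | s A. s \<le> t \<and> A \<in> sets borel}))"

text \<open>All processes are indexed by \<open>nat\<close>; only their values at times \<open>t \<le> T\<close> are constrained.\<close>

definition adapted ::
    "(nat \<Rightarrow> 'a measure) \<Rightarrow> nat \<Rightarrow> (nat \<Rightarrow> 'a \<Rightarrow> 'b::topological_space) \<Rightarrow> bool" where
  "adapted F T V \<longleftrightarrow> (\<forall>t\<le>T. V t \<in> borel_measurable (F t))"

text \<open>The last clause expresses \<open>\<F> = \<F>\<^sub>T\<close>; in particular \<open>P\<close> is complete.\<close>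

definition basis_process_setting ::
    "'a measure \<Rightarrow> nat \<Rightarrow> (nat \<Rightarrow> 'a \<Rightarrow> real ^ 'm) \<Rightarrow> bool" where
  "basis_process_setting P T X \<longleftrightarrow>
     prob_space P \<and> 0 < T \<and>
     (\<forall>t\<le>T. X t \<in> borel_measurable P) \<and>
     (\<forall>t\<le>T. \<forall>\<omega>\<in>space P. X t \<omega> \<in> range (\<lambda>i. axis i 1)) \<and>
     sets P = sets (completed_filtration P X T)"

text \<open>\<open>M\<^sub>t = X\<^sub>t - E[X\<^sub>t | \<F>\<^sub>t\<^sub>-\<^sub>1]\<close> for \<open>t \<ge> 1\<close>, with the conditional expectation of
  the vector \<open>X\<^sub>t\<close> taken componentwise.\<close>

definition mart_diff ::
    "'a measure \<Rightarrow> (nat \<Rightarrow> 'a \<Rightarrow> real ^ 'm) \<Rightarrow> nat \<Rightarrow> 'a \<Rightarrow> real ^ 'm" where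
  "mart_diff P X t \<omega> =
     X t \<omega> - (\<chi> i. real_cond_exp P (completed_filtration P X (t - 1)) (\<lambda>\<omega>'. X t \<omega>' $ i) \<omega>)"

definition standard_data ::
    "'a measure \<Rightarrow> nat \<Rightarrow> (nat \<Rightarrow> 'a \<Rightarrow> real ^ 'm) \<Rightarrow> ('a \<Rightarrow> real) \<Rightarrow>
     ('a \<Rightarrow> nat \<Rightarrow> real \<Rightarrow> real ^ 'm \<Rightarrow> real) \<Rightarrow> (nat \<Rightarrow> 'a \<Rightarrow> real) \<Rightarrow> bool" where
  "standard_data P T X \<xi> f S \<longleftrightarrow>
     \<xi> \<in> borel_measurable (completed_filtration P X T) \<and> integrable P \<xi> \<and>
     (\<forall>y z. adapted (completed_filtration P X) T (\<lambda>t \<omega>. f \<omega> t y z)) \<and>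
     adapted (completed_filtration P X) T S \<and>
     (AE \<omega> in P. S T \<omega> \<le> \<xi> \<omega>)"

definition rbsde_solution ::
    "'a measure \<Rightarrow> nat \<Rightarrow> (nat \<Rightarrow> 'a \<Rightarrow> real ^ 'm) \<Rightarrow> ('a \<Rightarrow> real) \<Rightarrow>
     ('a \<Rightarrow> nat \<Rightarrow> real \<Rightarrow> real ^ 'm \<Rightarrow> real) \<Rightarrow> (nat \<Rightarrow> 'a \<Rightarrow> real) \<Rightarrow>
     (nat \<Rightarrow> 'a \<Rightarrow> real) \<Rightarrow> (nat \<Rightarrow> 'a \<Rightarrow> real ^ 'm) \<Rightarrow> (nat \<Rightarrow> 'a \<Rightarrow> real) \<Rightarrow> bool" where
  "rbsde_solution P T X \<xi> f S Y Z K \<longleftrightarrow>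
     adapted (completed_filtration P X) T Y \<and>
     adapted (completed_filtration P X) T Z \<and>
     adapted (completed_filtration P X) T K \<and>
     (\<forall>t\<le>T. AE \<omega> in P.
        Y t \<omega> = \<xi> \<omega> + (\<Sum>u\<in>{t..<T}. f \<omega> u (Y u \<omega>) (Z u \<omega>)) + K T \<omega> - K t \<omega>
               - (\<Sum>u\<in>{t..<T}. Z u \<omega> \<bullet> mart_diff P X (u + 1) \<omega>)) \<and>
     (\<forall>t\<le>T. integrable P (Y t) \<and> integrable P (Z t) \<and> integrable P (K t)) \<and>
     (\<forall>t\<le>T. AE \<omega> in P. S t \<omega> \<le> Y t \<omega>) \<and>
     (AE \<omega> in P. mono_on {0..T} (\<lambda>t. K t \<omega>)) \<and>
     (AE \<omega> in P. K 0 \<omega> = 0) \<and>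
     (AE \<omega> in P. (\<Sum>t\<in>{0..<T}. (Y t \<omega> - S t \<omega>) * (K (t + 1) \<omega> - K t \<omega>)) = 0)"

text \<open>Although \<^const>\<open>stopping_time\<close> quantifies over all times in \<open>nat\<close>, its condition at
  times \<open>s \<ge> T\<close> holds trivially for \<open>\<theta> \<le> T\<close>.\<close>

definition stopping_times_between ::
    "'a measure \<Rightarrow> nat \<Rightarrow> (nat \<Rightarrow> 'a \<Rightarrow> real ^ 'm) \<Rightarrow> nat \<Rightarrow> ('a \<Rightarrow> nat) set" where
  "stopping_times_between P T X t =
     {\<theta>. stopping_time (completed_filtration P X) \<theta> \<and> (\<forall>\<omega>\<in>space P. t \<le> \<theta> \<omega> \<and> \<theta> \<omega> \<le> T)}"

text \<open>\<open>V\<close> is (a version of) the essential supremum of a possibly uncountable family of random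
  variables: the \<open>P\<close>-a.s. least random variable dominating each member \<open>P\<close>-a.s.  The constant
  \<open>esssup\<close> of the library is the essential supremum of one function.\<close>

definition is_family_esssup :: "'a measure \<Rightarrow> ('a \<Rightarrow> ereal) set \<Rightarrow> ('a \<Rightarrow> ereal) \<Rightarrow> bool" where
  "is_family_esssup P \<G> V \<longleftrightarrow>
     V \<in> borel_measurable P \<and>
     (\<forall>G\<in>\<G>. AE \<omega> in P. G \<omega> \<le> V \<omega>) \<and>
     (\<forall>W\<in>borel_measurable P. (\<forall>G\<in>\<G>. AE \<omega> in P. G \<omega> \<le> W \<omega>) \<longrightarrow> (AE \<omega> in P. V \<omega> \<le> W \<omega>))"

end

theory Submission
  imports Defs
begin

text \<open>Since \<open>X\<close> takes finitely many values, the paths of \<open>X\<close> up to time \<open>t\<close> split the space into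
  finitely many fibers, and a function is \<open>\<F>\<^sub>t\<close>-measurable iff it is constant on each fiber of
  positive probability. Hence every random variable is a.s. bounded, so integrability of \<open>S\<close> and of
  the driver comes for free, and the process \<open>f(s, Y\<^sub>s, Z\<^sub>s)\<close> is adapted although \<open>f\<close> is not assumed
  jointly measurable.

  For a stopping time \<open>\<theta>\<close>, subtracting the equation at \<open>\<theta>\<close> from the equation at \<open>t\<close> shows that
  \<open>Y\<^sub>t\<close> minus the payoff of \<open>\<theta>\<close> equals \<open>K\<^sub>\<theta> - K\<^sub>t + (Y\<^sub>\<theta> - S\<^sub>\<theta>) 1{\<theta> < T}\<close> up to a stopped
  martingale transform with zero conditional expectation. This gap is nonnegative, and it vanishes
  for the first time \<open>s \<ge> t\<close> at which \<open>Y\<^sub>s = S\<^sub>s\<close> (or \<open>s = T\<close>), because \<open>K\<close> is flat while \<open>Y > S\<close>.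
  So the supremum is attained.\<close>

section \<open>The filtration generated by the paths and its completion\<close>

definition path_fiber :: "'a measure \<Rightarrow> (nat \<Rightarrow> 'a \<Rightarrow> 'b) \<Rightarrow> nat \<Rightarrow> 'a \<Rightarrow> 'a set" where
  "path_fiber P X t \<omega> = {\<omega>' \<in> space P. \<forall>s\<le>t. X s \<omega>' = X s \<omega>}"

text \<open>Constancy is asked only on fibers of positive probability, because the completion makes
  every subset of a null fiber measurable. The codomain carries no structure, so events and
  function-valued maps are covered too.\<close>

definition path_determined :: "'a measure \<Rightarrow> (nat \<Rightarrow> 'a \<Rightarrow> 'b) \<Rightarrow> nat \<Rightarrow> ('a \<Rightarrow> 'c) \<Rightarrow> bool" where
  "path_determined P X t g \<longleftrightarrow>
     (\<forall>\<omega>\<in>space P. emeasure P (path_fiber P X t \<omega>) \<noteq> 0 \<longrightarrow>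
        (\<forall>\<omega>'\<in>path_fiber P X t \<omega>. g \<omega>' = g \<omega>))"

locale basis_process =
  fixes P :: "'a measure" and T :: nat and X :: "nat \<Rightarrow> 'a \<Rightarrow> real ^ 'm"
  assumes setting: "basis_process_setting P T X"
begin

sublocale prob_space P
  using setting by (simp add: basis_process_setting_def)

abbreviation F :: "nat \<Rightarrow> 'a measure" where
  "F \<equiv> completed_filtration P X"

abbreviation raw_filtration :: "nat \<Rightarrow> 'a measure" where
  "raw_filtration t \<equiv> sigma (space P) {X s -` A \<inter> space P | s A. s \<le> t \<and> A \<in> sets borel}"

abbreviation fiber :: "nat \<Rightarrow> 'a \<Rightarrow> 'a set" where
  "fiber \<equiv> path_fiber P X"

abbreviation determined :: "nat \<Rightarrow> ('a \<Rightarrow> 'c) \<Rightarrow> bool" where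
  "determined \<equiv> path_determined P X"

definition null_paths :: "nat \<Rightarrow> 'a set" where
  "null_paths t = {\<omega> \<in> space P. emeasure P (fiber t \<omega>) = 0}"

lemma X_measurable: "t \<le> T \<Longrightarrow> X t \<in> borel_measurable P"
  using setting by (simp add: basis_process_setting_def)

lemma X_basis: "t \<le> T \<Longrightarrow> \<omega> \<in> space P \<Longrightarrow> X t \<omega> \<in> range (\<lambda>i. axis i 1)"
  using setting by (simp add: basis_process_setting_def)

lemma sets_raw_filtration:
  "sets (raw_filtration t) =
     sigma_sets (space P) {X s -` A \<inter> space P | s A. s \<le> t \<and> A \<in> sets borel}"
  by (rule sets_measure_of) auto

lemma subalgebra_raw_filtration:
  assumes "t \<le> T" shows "subalgebra P (raw_filtration t)"
proof -
  have "sets (raw_filtration t) \<subseteq> sets P"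
    unfolding sets_raw_filtration
    using assms by (intro sets.sigma_sets_subset) (auto intro!: measurable_sets[OF X_measurable])
  then show ?thesis
    by (simp add: subalgebra_def space_measure_of_conv)
qed

lemma raw_filtration_mono:
  assumes "s \<le> t" shows "sets (raw_filtration s) \<subseteq> sets (raw_filtration t)"
  unfolding sets_raw_filtration using assms by (intro sigma_sets_mono') fastforce

lemma space_F [simp]: "space (F t) = space P"
  by (simp add: completed_filtration_def space_restr_to_subalg)

text \<open>The null sets of the restricted measure are the \<open>P\<close>-null sets lying in the
  raw \<sigma>-algebra. In this form, monotonicity in time passes from the raw filtration to the
  completed one.\<close>

lemma F_sets_iff:
  assumes "t \<le> T"
  shows "A \<in> sets (F t) \<longleftrightarrow>
    (\<exists>B N N'. A = B \<union> N \<and> B \<in> sets (raw_filtration t) \<and>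
       N' \<in> null_sets P \<inter> sets (raw_filtration t) \<and> N \<subseteq> N')"
  unfolding completed_filtration_def sets_completion
    null_sets_restr_to_subalg[OF subalgebra_raw_filtration[OF assms]]
    sets_restr_to_subalg[OF subalgebra_raw_filtration[OF assms]]
  by simp

lemma F_mono:
  assumes "s \<le> t" "t \<le> T" shows "sets (F s) \<subseteq> sets (F t)"
proof
  fix A assume "A \<in> sets (F s)"
  moreover have "s \<le> T" using assms by simp
  ultimately show "A \<in> sets (F t)"
    using raw_filtration_mono[OF assms(1)] unfolding F_sets_iff[OF \<open>s \<le> T\<close>] F_sets_iff[OF assms(2)]
    by blast
qed

lemma sets_F_final: "sets P = sets (F T)"
  using setting by (simp add: basis_process_setting_def)

lemma subalgebra_F: "t \<le> T \<Longrightarrow> subalgebra P (F t)"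
  using F_mono[of t T] by (simp add: subalgebra_def sets_F_final)

lemma sigma_finite_F: "t \<le> T \<Longrightarrow> sigma_finite_subalgebra P (F t)"
  by (intro finite_measure_subalgebra_is_sigma_finite finite_measure_subalgebra.intro
      finite_measure_subalgebra_axioms.intro subalgebra_F finite_measure_axioms)

lemma measurable_F_mono:
  assumes "s \<le> t" "t \<le> T" "g \<in> measurable (F s) N"
  shows "g \<in> measurable (F t) N"
  using assms(3) F_mono[OF assms(1,2)] unfolding measurable_def by auto

lemma borel_measurable_P_iff: "g \<in> borel_measurable P \<longleftrightarrow> g \<in> borel_measurable (F T)"
  by (rule measurable_cong_sets[THEN arg_cong, of P "F T" borel borel "\<lambda>S. g \<in> S"])
     (simp_all add: sets_F_final)

section \<open>Path fibers and null paths\<close>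

lemma fiber_self: "\<omega> \<in> space P \<Longrightarrow> \<omega> \<in> fiber t \<omega>"
  by (simp add: path_fiber_def)

lemma fiber_eq: "\<omega>' \<in> fiber t \<omega> \<Longrightarrow> fiber t \<omega>' = fiber t \<omega>"
  by (auto simp: path_fiber_def)

lemma fiber_in_raw_filtration: "fiber t \<omega> \<in> sets (raw_filtration t)"
proof -
  have "fiber t \<omega> = (\<Inter>s\<in>{..t}. X s -` {X s \<omega>} \<inter> space P)"
    by (auto simp: path_fiber_def)
  moreover have "X s -` {X s \<omega>} \<inter> space P \<in> sets (raw_filtration t)" if "s \<le> t" for s
    unfolding sets_raw_filtration using that by (intro sigma_sets.Basic CollectI exI conjI refl) auto
  ultimately show ?thesis by (simp only:, intro sets.finite_INT) auto
qed

lemma fiber_sets: "t \<le> T \<Longrightarrow> fiber t \<omega> \<in> sets P"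
  using fiber_in_raw_filtration[of t \<omega>] subalgebra_raw_filtration[of t] by (auto simp: subalgebra_def)

text \<open>A fiber is given by the tuple of basis vectors visited up to time \<open>t\<close>, and
  there are only finitely many such tuples.\<close>

lemma finite_fibers:
  assumes "t \<le> T" shows "finite (fiber t ` space P)"
proof -
  let ?E = "{..t} \<rightarrow>\<^sub>E range (\<lambda>i::'m. axis i (1::real))"
  have "finite ?E" by (intro finite_PiE) auto
  moreover have "fiber t ` space P \<subseteq> (\<lambda>x. {\<omega>' \<in> space P. \<forall>s\<le>t. X s \<omega>' = x s}) ` ?E"
  proof safe
    fix \<omega> assume "\<omega> \<in> space P"
    then have "restrict (\<lambda>s. X s \<omega>) {..t} \<in> ?E"
      using X_basis assms by (intro restrict_PiE_iff[THEN iffD2]) force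
    moreover have "fiber t \<omega> = {\<omega>' \<in> space P. \<forall>s\<le>t. X s \<omega>' = restrict (\<lambda>s. X s \<omega>) {..t} s}"
      by (auto simp: path_fiber_def)
    ultimately show "fiber t \<omega> \<in> (\<lambda>x. {\<omega>' \<in> space P. \<forall>s\<le>t. X s \<omega>' = x s}) ` ?E"
      by blast
  qed
  ultimately show ?thesis by (rule finite_surj)
qed

text \<open>Presents the exceptional set as a union of fibers. Only finitely many fibers occur even
  if the points are uncountable, so finite unions give both measurability and nullity.\<close>

lemma null_paths_eq: "null_paths t = \<Union>(fiber t ` null_paths t)"
proof
  show "null_paths t \<subseteq> \<Union>(fiber t ` null_paths t)"
    using fiber_self by (auto simp: null_paths_def)
  show "\<Union>(fiber t ` null_paths t) \<subseteq> null_paths t"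
  proof safe
    fix \<omega> \<omega>' assume "\<omega> \<in> null_paths t" "\<omega>' \<in> fiber t \<omega>"
    then show "\<omega>' \<in> null_paths t"
      using fiber_eq[of \<omega>' t \<omega>] by (auto simp: null_paths_def path_fiber_def)
  qed
qed

lemma finite_fibers_subset:
  assumes "t \<le> T" "A \<subseteq> space P" shows "finite (fiber t ` A)"
  by (rule finite_subset[OF image_mono[OF assms(2)] finite_fibers[OF assms(1)]])

lemma null_paths_null:
  assumes "t \<le> T" shows "null_paths t \<in> null_sets P \<inter> sets (raw_filtration t)"
proof -
  have sub: "null_paths t \<subseteq> space P" by (auto simp: null_paths_def)
  have "\<Union>(fiber t ` null_paths t) \<in> null_sets P"
    using finite_fibers_subset[OF assms sub] fiber_sets[OF assms]
    by (intro null_sets.finite_Union) (auto simp: null_paths_def null_sets_def)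
  moreover have "\<Union>(fiber t ` null_paths t) \<in> sets (raw_filtration t)"
    using finite_fibers_subset[OF assms sub] fiber_in_raw_filtration
    by (intro sets.finite_Union) auto
  ultimately show ?thesis using null_paths_eq[of t] by auto
qed

section \<open>Measurability as constancy on fibers of positive probability\<close>

text \<open>No generator separates two points of a fiber, and this property survives complements and
  countable unions.\<close>

lemma raw_filtration_saturated:
  assumes "B \<in> sets (raw_filtration t)" "\<omega> \<in> space P" "\<omega>' \<in> fiber t \<omega>"
  shows "\<omega>' \<in> B \<longleftrightarrow> \<omega> \<in> B"
  using assms(1) unfolding sets_raw_filtration
  by (induction rule: sigma_sets.induct) (use assms(2,3) in \<open>auto simp: path_fiber_def\<close>)

text \<open>A fiber of positive probability cannot meet the null set \<open>N'\<close>: by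
  saturation it would be contained in it. On such a fiber, membership in \<open>B\<close> is
  therefore membership in the raw part \<open>C\<close>.\<close>

lemma F_saturated:
  assumes t: "t \<le> T" and B: "B \<in> sets (F t)" and \<omega>: "\<omega> \<in> space P"
    and pos: "emeasure P (fiber t \<omega>) \<noteq> 0" and \<omega>': "\<omega>' \<in> fiber t \<omega>"
  shows "\<omega>' \<in> B \<longleftrightarrow> \<omega> \<in> B"
proof -
  obtain C N N' where C: "B = C \<union> N" "C \<in> sets (raw_filtration t)" "N \<subseteq> N'"
    and N': "N' \<in> null_sets P" "N' \<in> sets (raw_filtration t)"
    using B unfolding F_sets_iff[OF t] by blast
  have "\<omega> \<notin> N'"
  proof
    assume "\<omega> \<in> N'"
    then have "fiber t \<omega> \<subseteq> N'" using raw_filtration_saturated[OF N'(2) \<omega>] by blast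
    then have "emeasure P (fiber t \<omega>) \<le> emeasure P N'"
      using N' by (intro emeasure_mono) auto
    then show False using N' pos by (simp add: null_sets_def)
  qed
  moreover from this have "\<omega>' \<notin> N'" using raw_filtration_saturated[OF N'(2) \<omega> \<omega>'] by blast
  ultimately show ?thesis
    using C raw_filtration_saturated[OF C(2) \<omega> \<omega>'] by blast
qed

lemma determinedD:
  assumes "determined t g" "\<omega> \<in> space P" "emeasure P (fiber t \<omega>) \<noteq> 0" "\<omega>' \<in> fiber t \<omega>"
  shows "g \<omega>' = g \<omega>"
  using assms unfolding path_determined_def by blast

lemma determined_comp2:
  assumes "determined t g" "determined t h" shows "determined t (\<lambda>\<omega>. k (g \<omega>) (h \<omega>))"
  unfolding path_determined_def
proof (intro ballI impI)
  fix \<omega> \<omega>' assume \<omega>: "\<omega> \<in> space P" "emeasure P (fiber t \<omega>) \<noteq> 0" "\<omega>' \<in> fiber t \<omega>"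
  show "k (g \<omega>') (h \<omega>') = k (g \<omega>) (h \<omega>)"
    unfolding determinedD[OF assms(1) \<omega>] determinedD[OF assms(2) \<omega>] ..
qed

lemma determined_comp: "determined t g \<Longrightarrow> determined t (\<lambda>\<omega>. k (g \<omega>))"
  by (rule determined_comp2[where k = "\<lambda>x _. k x"])

lemma determined_fun:
  assumes "\<And>i. determined t (g i)" shows "determined t (\<lambda>\<omega> i. g i \<omega>)"
  unfolding path_determined_def
proof (intro ballI impI ext)
  fix \<omega> \<omega>' i assume \<omega>: "\<omega> \<in> space P" "emeasure P (fiber t \<omega>) \<noteq> 0" "\<omega>' \<in> fiber t \<omega>"
  show "g i \<omega>' = g i \<omega>" by (rule determinedD[OF assms \<omega>])
qed

text \<open>Singletons are closed in a \<open>t1_space\<close>, so the preimage of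
  \<open>{g \<omega>}\<close> is measurable and saturation gives constancy. Conversely, finiteness
  of the set of fibers makes every preimage measurable.\<close>

lemma measurable_F_iff:
  fixes g :: "'a \<Rightarrow> 'c::t1_space"
  assumes t: "t \<le> T"
  shows "g \<in> borel_measurable (F t) \<longleftrightarrow> determined t g"
proof
  assume g: "g \<in> borel_measurable (F t)"
  show "determined t g"
    unfolding path_determined_def
  proof (intro ballI impI)
    fix \<omega> \<omega>' assume \<omega>: "\<omega> \<in> space P" "emeasure P (fiber t \<omega>) \<noteq> 0" and \<omega>': "\<omega>' \<in> fiber t \<omega>"
    have "g -` {g \<omega>} \<inter> space (F t) \<in> sets (F t)"
      by (rule measurable_sets[OF g]) simp
    from F_saturated[OF t this \<omega> \<omega>'] show "g \<omega>' = g \<omega>" using \<omega> by simp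
  qed
next
  assume g: "determined t g"
  show "g \<in> borel_measurable (F t)"
  proof (rule measurableI)
    fix A :: "'c set"
    let ?B = "g -` A \<inter> space P"
    \<comment> \<open>Up to null paths, the preimage is the finite union \<open>?C\<close> of its
      fibers of positive probability; the remainder lies in a null set and is absorbed by the
      completion.\<close>
    let ?C = "\<Union>(fiber t ` (?B - null_paths t))"
    have "?C \<subseteq> ?B"
    proof safe
      fix \<omega> \<omega>' assume \<omega>: "\<omega> \<in> space P" "g \<omega> \<in> A" "\<omega> \<notin> null_paths t"
        and \<omega>': "\<omega>' \<in> fiber t \<omega>"
      then have "g \<omega>' = g \<omega>" by (intro determinedD[OF g]) (auto simp: null_paths_def)
      then show "\<omega>' \<in> g -` A" "\<omega>' \<in> space P"
        using \<omega> \<omega>' by (auto simp: path_fiber_def)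
    qed
    moreover have "?B - null_paths t \<subseteq> ?C" using fiber_self by blast
    ultimately have "?B = ?C \<union> (?B \<inter> null_paths t)" by blast
    moreover have "?C \<in> sets (raw_filtration t)"
      using fiber_in_raw_filtration
      by (intro sets.finite_Union finite_fibers_subset[OF t]) auto
    moreover have "?B \<inter> null_paths t \<subseteq> null_paths t" by simp
    ultimately show "g -` A \<inter> space (F t) \<in> sets (F t)"
      unfolding space_F using null_paths_null[OF t] by (intro F_sets_iff[OF t, THEN iffD2] exI conjI)
  qed simp
qed

text \<open>Fibers shrink as time grows, so a fiber of positive probability at \<open>t\<close> lies
  in one of positive probability at \<open>s\<close>.\<close>

lemma determined_mono:
  assumes "determined s g" "s \<le> t" "t \<le> T" shows "determined t g"
  unfolding path_determined_def
proof (intro ballI impI)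
  fix \<omega> \<omega>' assume \<omega>: "\<omega> \<in> space P" "emeasure P (fiber t \<omega>) \<noteq> 0" "\<omega>' \<in> fiber t \<omega>"
  have sub: "fiber t \<omega> \<subseteq> fiber s \<omega>" using assms(2) by (auto simp: path_fiber_def)
  then have "emeasure P (fiber t \<omega>) \<le> emeasure P (fiber s \<omega>)"
    using assms by (intro emeasure_mono fiber_sets) auto
  with \<omega> have "emeasure P (fiber s \<omega>) \<noteq> 0" by auto
  then show "g \<omega>' = g \<omega>" using determinedD[OF assms(1) \<omega>(1)] sub \<omega>(3) by blast
qed

section \<open>Integrability of all random variables\<close>

text \<open>Off the null paths, \<open>g\<close> is constant on each of finitely many fibers. It
  thus takes finitely many values there and is a.s. bounded.\<close>

lemma integrable_if_measurable:
  fixes g :: "'a \<Rightarrow> real"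
  assumes "g \<in> borel_measurable P"
  shows "integrable P g"
proof -
  have det: "determined T g"
    using assms measurable_F_iff[of T g] by (simp add: borel_measurable_P_iff)
  let ?R = "space P - null_paths T"
  have "g ` ?R \<subseteq> (\<lambda>A. g (SOME \<omega>. \<omega> \<in> A)) ` fiber T ` ?R"
  proof safe
    fix \<omega> assume \<omega>: "\<omega> \<in> space P" "\<omega> \<notin> null_paths T"
    have "(SOME \<omega>'. \<omega>' \<in> fiber T \<omega>) \<in> fiber T \<omega>" using fiber_self[OF \<omega>(1)] by (rule someI)
    then have "g \<omega> = g (SOME \<omega>'. \<omega>' \<in> fiber T \<omega>)"
      using determinedD[OF det \<omega>(1)] \<omega> by (auto simp: null_paths_def)
    then show "g \<omega> \<in> (\<lambda>A. g (SOME \<omega>. \<omega> \<in> A)) ` fiber T ` ?R" using \<omega> by blast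
  qed
  then have "finite (g ` ?R)"
    by (rule finite_subset) (intro finite_imageI finite_fibers_subset; auto)
  then obtain B where B: "\<And>x. x \<in> g ` ?R \<Longrightarrow> \<bar>x\<bar> \<le> B"
    using finite_imp_bounded[THEN bounded_real[THEN iffD1]] by blast
  have "AE \<omega> in P. \<omega> \<notin> null_paths T"
    using null_paths_null[of T] by (intro AE_not_in) auto
  then have "AE \<omega> in P. norm (g \<omega>) \<le> B"
    by (rule AE_mp) (rule AE_I2, use B in auto)
  then show ?thesis using assms by (rule integrable_const_bound)
qed

lemma integrable_if_determined:
  fixes g :: "'a \<Rightarrow> real"
  assumes "determined t g" "t \<le> T" shows "integrable P g"
proof -
  have "determined T g" using assms determined_mono by blast
  then show ?thesis
    using measurable_F_iff[of T g] borel_measurable_P_iff integrable_if_measurable by blast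
qed

section \<open>Martingale differences and their transforms\<close>

lemma X_determined: "s \<le> t \<Longrightarrow> determined t (X s)"
  by (simp add: path_determined_def path_fiber_def)

lemma mart_diff_determined:
  assumes "u < T" shows "determined (Suc u) (mart_diff P X (Suc u))"
proof -
  have u: "u \<le> T" "u \<le> Suc u" "Suc u \<le> T" using assms by simp_all
  have c: "determined (Suc u) (real_cond_exp P (F u) h)" for h
    by (rule determined_mono[OF measurable_F_iff[OF u(1), THEN iffD1] u(2,3)]) simp
  show ?thesis
    unfolding mart_diff_def[abs_def] diff_Suc_1
    \<comment> \<open>The conditional expectations of the coordinates are bundled by
      \<open>determined_fun\<close> into one function of the index, which \<open>vec_lambda\<close>
      turns into a vector.\<close>
    by (rule determined_comp2[where k = "\<lambda>x e. x - vec_lambda e", OF X_determined determined_fun])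
       (simp_all add: c)
qed

text \<open>The claim is tested on sets of \<open>F t\<close>. These also belong to
  \<open>F u\<close>, so their indicators join the \<open>F u\<close>-measurable weights, and the
  defining property of the conditional expectation given \<open>F u\<close> makes each coordinate
  vanish. No separate tower argument occurs.\<close>

lemma cond_exp_mart_transform:
  assumes tu: "t \<le> u" "u < T" and c: "determined u c" and Z: "determined u Z"
  shows "AE \<omega> in P. real_cond_exp P (F t) (\<lambda>\<omega>. c \<omega> * (Z \<omega> \<bullet> mart_diff P X (Suc u) \<omega>)) \<omega> = 0"
proof -
  interpret Ft: sigma_finite_subalgebra P "F t" using tu by (intro sigma_finite_F) simp
  interpret Fu: sigma_finite_subalgebra P "F u" using tu by (intro sigma_finite_F) simp
  let ?E = "\<lambda>i. real_cond_exp P (F u) (\<lambda>\<omega>. X (Suc u) \<omega> $ i)"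
  let ?D = "\<lambda>\<omega>. c \<omega> * (Z \<omega> \<bullet> mart_diff P X (Suc u) \<omega>)"
  have u: "u \<le> Suc u" "Suc u \<le> T" using tu by simp_all
  have "determined (Suc u) ?D"
    by (intro determined_comp2[where k = "(*)"] determined_comp2[where k = "(\<bullet>)"]
        determined_mono[OF c u] determined_mono[OF Z u] mart_diff_determined tu)
  then have int: "integrable P ?D" using tu by (intro integrable_if_determined[of "Suc u"]) auto
  show ?thesis
  proof (rule Ft.real_cond_exp_charact[OF _ int])
    fix A assume "A \<in> sets (F t)"
    then have A: "A \<in> sets (F u)" using F_mono[of t u] tu by auto
    let ?h = "\<lambda>i \<omega>. indicator A \<omega> * c \<omega> * Z \<omega> $ i"
    have h: "?h i \<in> borel_measurable (F u)" for i
    proof -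
      have "c \<in> borel_measurable (F u)" using c tu measurable_F_iff[of u c] by simp
      moreover have "(\<lambda>\<omega>. Z \<omega> $ i) \<in> borel_measurable (F u)"
        using determined_comp[OF Z] tu measurable_F_iff[of u "\<lambda>\<omega>. Z \<omega> $ i"] by simp
      ultimately show ?thesis using A by measurable
    qed
    have X: "(\<lambda>\<omega>. X (Suc u) \<omega> $ i) \<in> borel_measurable P" for i
      using tu X_measurable[of "Suc u"] by (intro measurable_compose[OF _ borel_measurable_nth]) simp
    have hX: "integrable P (\<lambda>\<omega>. ?h i \<omega> * X (Suc u) \<omega> $ i)" for i
      using measurable_from_subalg[OF Fu.subalg h[of i]] X[of i]
      by (intro integrable_if_measurable borel_measurable_times[of "?h i"])
    have hE: "integrable P (\<lambda>\<omega>. ?h i \<omega> * ?E i \<omega>)"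
      "(\<integral>\<omega>. ?h i \<omega> * ?E i \<omega> \<partial>P) = (\<integral>\<omega>. ?h i \<omega> * X (Suc u) \<omega> $ i \<partial>P)" for i
      using Fu.real_cond_exp_intg[OF hX h X] by blast+
    have "(\<integral>\<omega>\<in>A. ?D \<omega> \<partial>P)
        = (\<integral>\<omega>. (\<Sum>i\<in>UNIV. ?h i \<omega> * X (Suc u) \<omega> $ i - ?h i \<omega> * ?E i \<omega>) \<partial>P)"
      unfolding set_lebesgue_integral_def
      by (intro Bochner_Integration.integral_cong refl)
         (simp add: inner_vec_def mart_diff_def sum_distrib_left right_diff_distrib mult.assoc)
    also have "\<dots> = (\<Sum>i\<in>UNIV. \<integral>\<omega>. ?h i \<omega> * X (Suc u) \<omega> $ i - ?h i \<omega> * ?E i \<omega> \<partial>P)"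
      by (intro Bochner_Integration.integral_sum Bochner_Integration.integrable_diff hX hE(1))
    also have "\<dots> = 0"
      by (intro sum.neutral ballI)
         (simp only: Bochner_Integration.integral_diff[OF hX hE(1)] hE(2) diff_self)
    finally show "(\<integral>\<omega>\<in>A. ?D \<omega> \<partial>P) = (\<integral>\<omega>\<in>A. 0 \<partial>P)" by (simp add: set_lebesgue_integral_def)
  qed simp_all
qed

section \<open>Stopping times on fibers\<close>

lemma stopping_time_event_determined:
  assumes "\<theta> \<in> stopping_times_between P T X t" "u \<le> T"
  shows "determined u (\<lambda>\<omega>. u < \<theta> \<omega>)"
proof -
  have [measurable]: "Measurable.pred (F u) (\<lambda>\<omega>. u < \<theta> \<omega>)"
    using assms by (intro stopping_timeD2) (simp add: stopping_times_between_def)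
  \<comment> \<open>\<open>measurable_F_iff\<close> concerns Borel functions, so the event passes
    through its real indicator and is recovered by comparison with 1.\<close>
  have "(\<lambda>\<omega>. if u < \<theta> \<omega> then 1 else 0 :: real) \<in> borel_measurable (F u)"
    by measurable
  then have "determined u (\<lambda>\<omega>. if u < \<theta> \<omega> then 1 else 0 :: real)"
    using measurable_F_iff[OF assms(2)] by blast
  then have "determined u (\<lambda>\<omega>. (if u < \<theta> \<omega> then 1 else 0 :: real) = 1)"
    by (rule determined_comp)
  moreover have "(\<lambda>\<omega>. (if u < \<theta> \<omega> then 1 else 0 :: real) = 1) = (\<lambda>\<omega>. u < \<theta> \<omega>)"
    by auto
  ultimately show ?thesis by simp
qed

text \<open>Points of one fiber agree on every event \<open>u < \<theta> \<omega>\<close> with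
  \<open>u \<le> T\<close>. Taking for \<open>u\<close> each of the two values of \<theta> excludes
  both strict inequalities.\<close>

lemma stopping_time_determined:
  assumes "\<theta> \<in> stopping_times_between P T X t"
  shows "determined T \<theta>"
  unfolding path_determined_def
proof (intro ballI impI)
  fix \<omega> \<omega>' assume \<omega>: "\<omega> \<in> space P" "emeasure P (fiber T \<omega>) \<noteq> 0" "\<omega>' \<in> fiber T \<omega>"
  have iff: "u < \<theta> \<omega>' \<longleftrightarrow> u < \<theta> \<omega>" if "u \<le> T" for u
    using determinedD[OF determined_mono[OF stopping_time_event_determined[OF assms that] that order_refl] \<omega>] .
  have "\<theta> \<omega> \<le> T" "\<theta> \<omega>' \<le> T"
    using assms \<omega> by (auto simp: stopping_times_between_def path_fiber_def)
  from iff[OF this(1)] iff[OF this(2)] show "\<theta> \<omega>' = \<theta> \<omega>" by simp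
qed

end

section \<open>The reflected equation and its payoffs\<close>

locale reflected_bsde = basis_process P T X
  for P :: "'a measure" and T :: nat and X :: "nat \<Rightarrow> 'a \<Rightarrow> real ^ 'm" +
  fixes \<xi> :: "'a \<Rightarrow> real" and f :: "'a \<Rightarrow> nat \<Rightarrow> real \<Rightarrow> real ^ 'm \<Rightarrow> real"
    and S Y K :: "nat \<Rightarrow> 'a \<Rightarrow> real" and Z :: "nat \<Rightarrow> 'a \<Rightarrow> real ^ 'm"
  assumes data: "standard_data P T X \<xi> f S"
    and solution: "rbsde_solution P T X \<xi> f S Y Z K"
begin

abbreviation payoff :: "nat \<Rightarrow> ('a \<Rightarrow> nat) \<Rightarrow> 'a \<Rightarrow> real" where
  "payoff t \<theta> \<equiv> \<lambda>\<omega>. (\<Sum>s\<in>{t..<\<theta> \<omega>}. f \<omega> s (Y s \<omega>) (Z s \<omega>))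
     + S (\<theta> \<omega>) \<omega> * indicator {\<omega>'. \<theta> \<omega>' < T} \<omega> + \<xi> \<omega> * indicator {\<omega>'. \<theta> \<omega>' = T} \<omega>"

abbreviation dM :: "nat \<Rightarrow> 'a \<Rightarrow> real" where
  "dM u \<equiv> \<lambda>\<omega>. Z u \<omega> \<bullet> mart_diff P X (Suc u) \<omega>"

text \<open>Zero beyond the horizon, because the library's linearity of \<open>real_cond_exp\<close> over finite sums
  asks for integrability at every index.\<close>

definition stopped_dM :: "('a \<Rightarrow> nat) \<Rightarrow> nat \<Rightarrow> 'a \<Rightarrow> real" where
  "stopped_dM \<theta> u \<omega> = (if u < T then of_bool (u < \<theta> \<omega>) * dM u \<omega> else 0)"

lemma determined_data:
  shows S_determined: "t \<le> T \<Longrightarrow> determined t (S t)"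
    and Y_determined: "t \<le> T \<Longrightarrow> determined t (Y t)"
    and Z_determined: "t \<le> T \<Longrightarrow> determined t (Z t)"
    and f_determined: "t \<le> T \<Longrightarrow> determined t (\<lambda>\<omega>. f \<omega> t y z)"
    and xi_determined: "determined T \<xi>"
proof -
  have m: "t \<le> T \<Longrightarrow> S t \<in> borel_measurable (F t)" "t \<le> T \<Longrightarrow> Y t \<in> borel_measurable (F t)"
    "t \<le> T \<Longrightarrow> Z t \<in> borel_measurable (F t)" "t \<le> T \<Longrightarrow> (\<lambda>\<omega>. f \<omega> t y z) \<in> borel_measurable (F t)"
    "\<xi> \<in> borel_measurable (F T)"
    using data solution by (simp_all add: standard_data_def rbsde_solution_def adapted_def)
  show "t \<le> T \<Longrightarrow> determined t (S t)" "t \<le> T \<Longrightarrow> determined t (Y t)"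
    "t \<le> T \<Longrightarrow> determined t (Z t)" "t \<le> T \<Longrightarrow> determined t (\<lambda>\<omega>. f \<omega> t y z)" "determined T \<xi>"
    by (rule measurable_F_iff[THEN iffD1]; simp add: m)+
qed

text \<open>On a fiber of positive probability \<open>Y s\<close> and \<open>Z s\<close> each have a
  single value. Substituting these into \<open>f\<close> leaves the case of fixed \<open>y\<close>
  and \<open>z\<close>, where adaptedness applies.\<close>

lemma payoff_determined:
  assumes \<theta>: "\<theta> \<in> stopping_times_between P T X t"
  shows "determined T (payoff t \<theta>)"
  unfolding path_determined_def
proof (intro ballI impI)
  fix \<omega> \<omega>' assume \<omega>: "\<omega> \<in> space P" "emeasure P (fiber T \<omega>) \<noteq> 0" "\<omega>' \<in> fiber T \<omega>"
  have le: "\<theta> \<omega> \<le> T" using \<theta> \<omega> by (simp add: stopping_times_between_def)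
  have eq: "\<theta> \<omega>' = \<theta> \<omega>" "\<xi> \<omega>' = \<xi> \<omega>"
    using determinedD[OF stopping_time_determined[OF \<theta>] \<omega>] determinedD[OF xi_determined \<omega>] by auto
  have *: "S s \<omega>' = S s \<omega>" "Y s \<omega>' = Y s \<omega>" "Z s \<omega>' = Z s \<omega>" "f \<omega>' s y z = f \<omega> s y z"
    if "s \<le> T" for s y z
    using determinedD[OF determined_mono[OF S_determined that order_refl] \<omega>]
      determinedD[OF determined_mono[OF Y_determined that order_refl] \<omega>]
      determinedD[OF determined_mono[OF Z_determined that order_refl] \<omega>]
      determinedD[OF determined_mono[OF f_determined that order_refl] \<omega>] that by auto
  have "(\<Sum>s\<in>{t..<\<theta> \<omega>'}. f \<omega>' s (Y s \<omega>') (Z s \<omega>')) = (\<Sum>s\<in>{t..<\<theta> \<omega>}. f \<omega> s (Y s \<omega>) (Z s \<omega>))"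
    unfolding eq using le * by (intro sum.cong) auto
  then show "payoff t \<theta> \<omega>' = payoff t \<theta> \<omega>"
    using * le eq by (simp add: indicator_def)
qed

lemma cond_exp_stopped_dM:
  assumes "t \<le> u" "u < T" "\<theta> \<in> stopping_times_between P T X t"
  shows "AE \<omega> in P. real_cond_exp P (F t) (stopped_dM \<theta> u) \<omega> = 0"
proof -
  have "determined u (\<lambda>\<omega>. of_bool (u < \<theta> \<omega>) :: real)"
    by (rule determined_comp[OF stopping_time_event_determined[OF assms(3)]]) (use assms(2) in simp)
  from cond_exp_mart_transform[OF assms(1,2) this Z_determined] show ?thesis
    using assms(2) by (simp add: stopped_dM_def[abs_def])
qed

lemma integrable_stopped_dM:
  assumes "\<theta> \<in> stopping_times_between P T X t"
  shows "integrable P (stopped_dM \<theta> u)"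
proof (cases "u < T")
  case True
  then have u: "u \<le> T" "u \<le> Suc u" "Suc u \<le> T" by simp_all
  have det: "determined (Suc u) (\<lambda>\<omega>. u < \<theta> \<omega>)" "determined (Suc u) (Z u)"
    by (rule determined_mono[OF stopping_time_event_determined[OF assms u(1)] u(2,3)]
        determined_mono[OF Z_determined[OF u(1)] u(2,3)])+
  have "determined (Suc u) (stopped_dM \<theta> u)"
    unfolding stopped_dM_def[abs_def]
    using determined_comp2[where k = "\<lambda>x y. if u < T then x * y else 0",
        OF determined_comp[OF det(1), where k = of_bool]
           determined_comp2[where k = "(\<bullet>)", OF det(2) mart_diff_determined[OF True]]] .
  then show ?thesis using True by (intro integrable_if_determined[of "Suc u"]) auto
qed (simp add: stopped_dM_def[abs_def])

section \<open>The gap between \<open>Y\<close> and the payoff of a stopping time\<close>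

lemma gap_identity:
  assumes t: "t \<le> T" and \<theta>: "\<theta> \<in> stopping_times_between P T X t"
  shows "AE \<omega> in P. Y t \<omega> + (\<Sum>u\<in>{t..<T}. stopped_dM \<theta> u \<omega>) - payoff t \<theta> \<omega>
    = (K (\<theta> \<omega>) \<omega> - K t \<omega>) + of_bool (\<theta> \<omega> < T) * (Y (\<theta> \<omega>) \<omega> - S (\<theta> \<omega>) \<omega>)"
proof -
  \<comment> \<open>The equation holds a.s. at each fixed time. Finitely many times share one
    exceptional null set, outside which it may be evaluated at the random time
    \<open>\<theta> \<omega>\<close>.\<close>
  have "AE \<omega> in P. \<forall>t\<in>{..T}. 
        Y t \<omega> = \<xi> \<omega> + (\<Sum>u\<in>{t..<T}. f \<omega> u (Y u \<omega>) (Z u \<omega>)) + K T \<omega> - K t \<omega>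
               - (\<Sum>u\<in>{t..<T}. dM u \<omega>)"
    using solution unfolding rbsde_solution_def by (intro AE_finite_allI) auto
  then show ?thesis
  proof (rule AE_mp, intro AE_I2 impI)
    fix \<omega> assume \<omega>: "\<omega> \<in> space P"
      and eq: "\<forall>t\<in>{..T}. 
        Y t \<omega> = \<xi> \<omega> + (\<Sum>u\<in>{t..<T}. f \<omega> u (Y u \<omega>) (Z u \<omega>)) + K T \<omega> - K t \<omega>
               - (\<Sum>u\<in>{t..<T}. dM u \<omega>)"
    have le: "t \<le> \<theta> \<omega>" "\<theta> \<omega> \<le> T" using \<theta> \<omega> by (auto simp: stopping_times_between_def)
    have split: "(\<Sum>u\<in>{t..<T}. h u) = (\<Sum>u\<in>{t..<\<theta> \<omega>}. h u) + (\<Sum>u\<in>{\<theta> \<omega>..<T}. h u)"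
      for h :: "nat \<Rightarrow> real"
      using le by (simp add: sum.atLeastLessThan_concat)
    have N: "(\<Sum>u\<in>{t..<T}. stopped_dM \<theta> u \<omega>) = (\<Sum>u\<in>{t..<\<theta> \<omega>}. dM u \<omega>)"
      unfolding split[of "\<lambda>u. stopped_dM \<theta> u \<omega>"] using le by (simp add: stopped_dM_def)
    note eqs = eq[rule_format, of t] eq[rule_format, of "\<theta> \<omega>"]
      split[of "\<lambda>u. f \<omega> u (Y u \<omega>) (Z u \<omega>)"] split[of "\<lambda>u. dM u \<omega>"] N
    show "Y t \<omega> + (\<Sum>u\<in>{t..<T}. stopped_dM \<theta> u \<omega>) - payoff t \<theta> \<omega>
      = (K (\<theta> \<omega>) \<omega> - K t \<omega>) + of_bool (\<theta> \<omega> < T) * (Y (\<theta> \<omega>) \<omega> - S (\<theta> \<omega>) \<omega>)"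
    proof (cases "\<theta> \<omega> < T")
      case True
      then have "payoff t \<theta> \<omega> = (\<Sum>s\<in>{t..<\<theta> \<omega>}. f \<omega> s (Y s \<omega>) (Z s \<omega>)) + S (\<theta> \<omega>) \<omega>"
        "of_bool (\<theta> \<omega> < T) * (Y (\<theta> \<omega>) \<omega> - S (\<theta> \<omega>) \<omega>) = Y (\<theta> \<omega>) \<omega> - S (\<theta> \<omega>) \<omega>"
        by simp_all
      with eqs t le show ?thesis unfolding atMost_iff by linarith
    next
      \<comment> \<open>Here \<open>\<theta> \<omega> = T\<close>: all sums after \<theta> are
        empty, the equation at \<open>T\<close> reduces to
        \<open>Y T \<omega> = \<xi> \<omega>\<close>, and only the increment of \<open>K\<close>
        remains.\<close>
      case False
      then have "payoff t \<theta> \<omega> = (\<Sum>s\<in>{t..<\<theta> \<omega>}. f \<omega> s (Y s \<omega>) (Z s \<omega>)) + \<xi> \<omega>"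
        "of_bool (\<theta> \<omega> < T) * (Y (\<theta> \<omega>) \<omega> - S (\<theta> \<omega>) \<omega>) = 0"
        "(\<Sum>u\<in>{\<theta> \<omega>..<T}. f \<omega> u (Y u \<omega>) (Z u \<omega>)) = 0" "(\<Sum>u\<in>{\<theta> \<omega>..<T}. dM u \<omega>) = 0"
        "K (\<theta> \<omega>) \<omega> = K T \<omega>"
        using le by simp_all
      with eqs t le show ?thesis unfolding atMost_iff by linarith
    qed
  qed
qed

lemma gap_measurable:
  assumes t: "t \<le> T" and \<theta>: "\<theta> \<in> stopping_times_between P T X t"
  shows "(\<lambda>\<omega>. Y t \<omega> + (\<Sum>u\<in>{t..<T}. stopped_dM \<theta> u \<omega>) - payoff t \<theta> \<omega>) \<in> borel_measurable P"
  using integrable_if_determined[OF Y_determined[OF t] t] integrable_stopped_dM[OF \<theta>]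
    integrable_if_determined[OF payoff_determined[OF \<theta>] order_refl]
  by (intro borel_measurable_integrable) simp

text \<open>\<open>Y t\<close> is \<open>F t\<close>-measurable and the stopped martingale terms
  have zero conditional expectation. Sign or vanishing of the gap thus becomes a comparison of
  \<open>Y t\<close> with the conditional payoff.\<close>

lemma cond_exp_gap:
  assumes t: "t \<le> T" and \<theta>: "\<theta> \<in> stopping_times_between P T X t"
  shows "AE \<omega> in P. real_cond_exp P (F t)
      (\<lambda>\<omega>. Y t \<omega> + (\<Sum>u\<in>{t..<T}. stopped_dM \<theta> u \<omega>) - payoff t \<theta> \<omega>) \<omega>
    = Y t \<omega> - real_cond_exp P (F t) (payoff t \<theta>) \<omega>"
proof -
  interpret Ft: sigma_finite_subalgebra P "F t" by (rule sigma_finite_F[OF t])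
  let ?N = "\<lambda>\<omega>. \<Sum>u\<in>{t..<T}. stopped_dM \<theta> u \<omega>"
  have Y: "integrable P (Y t)" using Y_determined[OF t] t by (rule integrable_if_determined)
  have Ym: "Y t \<in> borel_measurable (F t)" using Y_determined[OF t] measurable_F_iff[OF t] by blast
  have N: "integrable P ?N" using integrable_stopped_dM[OF \<theta>] by simp
  have g: "integrable P (payoff t \<theta>)"
    using payoff_determined[OF \<theta>] order_refl by (rule integrable_if_determined)
  have "AE \<omega> in P. \<forall>u\<in>{t..<T}. real_cond_exp P (F t) (stopped_dM \<theta> u) \<omega> = 0"
    using cond_exp_stopped_dM[OF _ _ \<theta>] by (intro AE_finite_allI) auto
  moreover have "AE \<omega> in P. real_cond_exp P (F t) ?N \<omega>
      = (\<Sum>u\<in>{t..<T}. real_cond_exp P (F t) (stopped_dM \<theta> u) \<omega>)"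
    by (rule Ft.real_cond_exp_sum[OF integrable_stopped_dM[OF \<theta>]])
  moreover note Ft.real_cond_exp_F_meas[OF Y Ym] Ft.real_cond_exp_add[OF Y N]
    Ft.real_cond_exp_diff[OF Bochner_Integration.integrable_add[OF Y N] g]
  ultimately show ?thesis
  proof eventually_elim
    case (elim \<omega>)
    have "real_cond_exp P (F t) ?N \<omega> = 0"
      unfolding elim(2) using elim(1) by (intro sum.neutral)
    then show ?case using elim(3-5) by linarith
  qed
qed

section \<open>\<open>Y\<close> dominates every conditional payoff\<close>

lemma K_mono: "AE \<omega> in P. mono_on {0..T} (\<lambda>t. K t \<omega>)"
  and K_flat: "AE \<omega> in P. (\<Sum>s\<in>{0..<T}. (Y s \<omega> - S s \<omega>) * (K (s + 1) \<omega> - K s \<omega>)) = 0"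
  using solution unfolding rbsde_solution_def by blast+

text \<open>A single null set serves all times, which permits evaluation at a stopping time.\<close>

lemma obstacle: "AE \<omega> in P. \<forall>s\<in>{..T}. S s \<omega> \<le> Y s \<omega>"
proof -
  have "\<forall>s\<le>T. AE \<omega> in P. S s \<omega> \<le> Y s \<omega>"
    using solution unfolding rbsde_solution_def by blast
  then show ?thesis by (intro AE_finite_allI) simp_all
qed

text \<open>Both terms of the gap are nonnegative: \<open>K\<close> increases from \<open>t\<close>
  to \<theta>, and \<open>Y\<close> lies above the obstacle at \<theta>. Conditional expectation
  preserves the sign.\<close>

lemma payoff_le_Y:
  assumes t: "t \<le> T" and \<theta>: "\<theta> \<in> stopping_times_between P T X t"
  shows "AE \<omega> in P. real_cond_exp P (F t) (payoff t \<theta>) \<omega> \<le> Y t \<omega>"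
proof -
  interpret Ft: sigma_finite_subalgebra P "F t" by (rule sigma_finite_F[OF t])
  let ?R = "\<lambda>\<omega>. Y t \<omega> + (\<Sum>u\<in>{t..<T}. stopped_dM \<theta> u \<omega>) - payoff t \<theta> \<omega>"
  from gap_identity[OF t \<theta>] AE_space K_mono obstacle have "AE \<omega> in P. 0 \<le> ?R \<omega>"
  proof eventually_elim
    case (elim \<omega>)
    have "t \<le> \<theta> \<omega>" "\<theta> \<omega> \<le> T" using \<theta> elim(2) by (auto simp: stopping_times_between_def)
    moreover from this have "K t \<omega> \<le> K (\<theta> \<omega>) \<omega>"
      using elim(3) by (auto intro: mono_onD)
    ultimately show ?case unfolding elim(1) using elim(4) by auto
  qed
  moreover note gap_measurable[OF t \<theta>]
  ultimately have "AE \<omega> in P. 0 \<le> real_cond_exp P (F t) ?R \<omega>"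
    by (rule Ft.real_cond_exp_pos)
  with cond_exp_gap[OF t \<theta>] show ?thesis by eventually_elim simp
qed

section \<open>Optimality of the first contact time\<close>

text \<open>The alternative \<open>s = T\<close> makes the minimum exist for
  \<open>t \<le> T\<close> on paths that never touch the obstacle.\<close>

definition first_contact :: "nat \<Rightarrow> 'a \<Rightarrow> nat" where
  "first_contact t \<omega> = (LEAST s. t \<le> s \<and> (s = T \<or> Y s \<omega> = S s \<omega>))"

lemma first_contact:
  assumes "t \<le> T"
  shows first_contact_ge: "t \<le> first_contact t \<omega>"
    and first_contact_le: "first_contact t \<omega> \<le> T"
    and first_contact_hit: "first_contact t \<omega> < T \<Longrightarrow>
      Y (first_contact t \<omega>) \<omega> = S (first_contact t \<omega>) \<omega>"
    and before_first_contact: "t \<le> s \<Longrightarrow> s < first_contact t \<omega> \<Longrightarrow> Y s \<omega> \<noteq> S s \<omega>"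
proof -
  let ?Q = "\<lambda>s. t \<le> s \<and> (s = T \<or> Y s \<omega> = S s \<omega>)"
  have "?Q (first_contact t \<omega>)"
    unfolding first_contact_def by (rule LeastI[of ?Q T]) (simp add: assms)
  then show "t \<le> first_contact t \<omega>"
    "first_contact t \<omega> < T \<Longrightarrow> Y (first_contact t \<omega>) \<omega> = S (first_contact t \<omega>) \<omega>" by auto
  show "first_contact t \<omega> \<le> T"
    unfolding first_contact_def by (rule Least_le) (simp add: assms)
  show "Y s \<omega> \<noteq> S s \<omega>" if "t \<le> s" "s < first_contact t \<omega>"
    using not_less_Least[OF that(2)[unfolded first_contact_def]] that(1) by auto
qed

text \<open>Before \<open>T\<close>, having stopped by time \<open>s\<close> means contact at one of
  the finitely many times from \<open>t\<close> to \<open>s\<close>. From \<open>T\<close> on, the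
  event is the whole space.\<close>

lemma first_contact_stopping_time:
  assumes t: "t \<le> T"
  shows "first_contact t \<in> stopping_times_between P T X t"
proof -
  have "Measurable.pred (F s) (\<lambda>\<omega>. first_contact t \<omega> \<le> s)" for s
  proof (cases "s < T")
    case True
    have "Measurable.pred (F s) (\<lambda>\<omega>. Y u \<omega> = S u \<omega>)" if "u \<in> {t..s}" for u
    proof -
      have u: "u \<le> T" "u \<le> s" "s \<le> T" using that True by simp_all
      have [measurable]: "Y u \<in> borel_measurable (F s)" "S u \<in> borel_measurable (F s)"
        using determined_mono[OF Y_determined[OF u(1)] u(2,3)]
          determined_mono[OF S_determined[OF u(1)] u(2,3)]
        by (simp_all add: measurable_F_iff[OF u(3)])
      show ?thesis by measurable
    qed
    then have "Measurable.pred (F s) (\<lambda>\<omega>. \<exists>u\<in>{t..s}. Y u \<omega> = S u \<omega>)"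
      by (intro pred_intros_finite) simp_all
    moreover have "first_contact t \<omega> \<le> s \<longleftrightarrow> (\<exists>u\<in>{t..s}. Y u \<omega> = S u \<omega>)" for \<omega>
    proof
      assume "first_contact t \<omega> \<le> s"
      then show "\<exists>u\<in>{t..s}. Y u \<omega> = S u \<omega>"
        using True first_contact_ge[OF t, of \<omega>] first_contact_hit[OF t, of \<omega>]
        by (intro bexI[of _ "first_contact t \<omega>"]) auto
    next
      assume "\<exists>u\<in>{t..s}. Y u \<omega> = S u \<omega>"
      then show "first_contact t \<omega> \<le> s"
        using before_first_contact[OF t, of _ \<omega>] by (meson atLeastAtMost_iff leI le_less_trans)
    qed
    ultimately show ?thesis by simp
  next
    case False
    then have "first_contact t \<omega> \<le> s" for \<omega>
      using first_contact_le[OF t, of \<omega>] by simp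
    then show ?thesis by simp
  qed
  then show ?thesis
    using first_contact_ge[OF t] first_contact_le[OF t]
    by (simp add: stopping_times_between_def stopping_time_def)
qed

lemma payoff_first_contact:
  assumes t: "t \<le> T"
  shows "AE \<omega> in P. real_cond_exp P (F t) (payoff t (first_contact t)) \<omega> = Y t \<omega>"
proof -
  interpret Ft: sigma_finite_subalgebra P "F t" by (rule sigma_finite_F[OF t])
  let ?\<theta> = "first_contact t"
  note \<theta> = first_contact_stopping_time[OF t]
  let ?R = "\<lambda>\<omega>. Y t \<omega> + (\<Sum>u\<in>{t..<T}. stopped_dM ?\<theta> u \<omega>) - payoff t ?\<theta> \<omega>"
  from gap_identity[OF t \<theta>] K_mono obstacle K_flat have "AE \<omega> in P. ?R \<omega> = 0"
  proof eventually_elim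
    case (elim \<omega>)
    have "(Y s \<omega> - S s \<omega>) * (K (s + 1) \<omega> - K s \<omega>) \<ge> 0" if "s \<in> {0..<T}" for s
      using elim(3) that by (auto intro!: mult_nonneg_nonneg mono_onD[OF elim(2)])
    \<comment> \<open>A vanishing sum of nonnegative terms forces each term to vanish.\<close>
    then have flat: "(Y s \<omega> - S s \<omega>) * (K (s + 1) \<omega> - K s \<omega>) = 0" if "s < T" for s
      using elim(4) that by (subst (asm) sum_nonneg_eq_0_iff) auto
    \<comment> \<open>Strictly before contact \<open>Y\<close> and \<open>S\<close> differ, so
      \<open>flat\<close> annihilates the increment of \<open>K\<close>. The increment at
      \<open>s\<close> leads to \<open>s + 1\<close>, so \<open>K\<close> stays constant up to and
      including the contact time.\<close>
    have "s \<le> ?\<theta> \<omega> \<longrightarrow> K s \<omega> = K t \<omega>" if "t \<le> s" for s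
      using that
    proof (induction s rule: dec_induct)
      case (step s)
      then show ?case
        using flat[of s] before_first_contact[OF t, of s \<omega>] first_contact_le[OF t, of \<omega>] by auto
    qed simp
    from this[OF first_contact_ge[OF t]] show ?case
      unfolding elim(1) using first_contact_hit[OF t, of \<omega>] by simp
  qed
  moreover note gap_measurable[OF t \<theta>]
  ultimately have "AE \<omega> in P. real_cond_exp P (F t) ?R \<omega> = real_cond_exp P (F t) (\<lambda>_. 0) \<omega>"
    by (intro Ft.real_cond_exp_cong) auto
  moreover have "AE \<omega> in P. real_cond_exp P (F t) (\<lambda>_. 0) \<omega> = 0"
    by (intro Ft.real_cond_exp_F_meas) auto
  ultimately show ?thesis using cond_exp_gap[OF t \<theta>] by eventually_elim simp
qed

text \<open>Leastness holds because the supremum is attained: any \<open>W\<close> dominating the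
  family dominates the conditional payoff of \<open>first_contact t\<close>, which is a.s.
  \<open>Y t\<close>.\<close>

lemma Y_is_esssup:
  assumes t: "t \<le> T"
  shows "is_family_esssup P
    ((\<lambda>\<theta> \<omega>. ereal (real_cond_exp P (F t) (payoff t \<theta>) \<omega>)) ` stopping_times_between P T X t)
    (\<lambda>\<omega>. ereal (Y t \<omega>))"
  unfolding is_family_esssup_def
proof (intro conjI ballI impI)
  have "Y t \<in> borel_measurable P"
    using integrable_if_determined[OF Y_determined[OF t] t] by simp
  then show "(\<lambda>\<omega>. ereal (Y t \<omega>)) \<in> borel_measurable P" by simp
next
  fix G assume "G \<in> (\<lambda>\<theta> \<omega>. ereal (real_cond_exp P (F t) (payoff t \<theta>) \<omega>)) ` stopping_times_between P T X t"
  then show "AE \<omega> in P. G \<omega> \<le> ereal (Y t \<omega>)"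
    using payoff_le_Y[OF t] by auto
next
  fix W assume "\<forall>G\<in>(\<lambda>\<theta> \<omega>. ereal (real_cond_exp P (F t) (payoff t \<theta>) \<omega>)) ` stopping_times_between P T X t.
    AE \<omega> in P. G \<omega> \<le> W \<omega>"
  then have "AE \<omega> in P. ereal (real_cond_exp P (F t) (payoff t (first_contact t)) \<omega>) \<le> W \<omega>"
    using first_contact_stopping_time[OF t] by simp
  with payoff_first_contact[OF t] show "AE \<omega> in P. ereal (Y t \<omega>) \<le> W \<omega>"
    by eventually_elim simp
qed

end

theorem proposition2p15:
  fixes P :: "'a measure" and T :: nat and X :: "nat \<Rightarrow> 'a \<Rightarrow> real ^ 'm"
    and \<xi> :: "'a \<Rightarrow> real" and f :: "'a \<Rightarrow> nat \<Rightarrow> real \<Rightarrow> real ^ 'm \<Rightarrow> real"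
    and S Y K :: "nat \<Rightarrow> 'a \<Rightarrow> real" and Z :: "nat \<Rightarrow> 'a \<Rightarrow> real ^ 'm"
  assumes "basis_process_setting P T X"
    and "standard_data P T X \<xi> f S"
    and "rbsde_solution P T X \<xi> f S Y Z K"
  shows "\<forall>t\<le>T. is_family_esssup P
           ((\<lambda>\<theta> \<omega>. ereal (real_cond_exp P (completed_filtration P X t)
                (\<lambda>\<omega>'. (\<Sum>s\<in>{t..<\<theta> \<omega>'}. f \<omega>' s (Y s \<omega>') (Z s \<omega>'))
                      + S (\<theta> \<omega>') \<omega>' * indicator {\<omega>''. \<theta> \<omega>'' < T} \<omega>'
                      + \<xi> \<omega>' * indicator {\<omega>''. \<theta> \<omega>'' = T} \<omega>') \<omega>))
              ` stopping_times_between P T X t)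
           (\<lambda>\<omega>. ereal (Y t \<omega>))"
proof -
  interpret reflected_bsde P T X \<xi> f S Y K Z
    by unfold_locales (fact assms)+
  show ?thesis using Y_is_esssup by blast
qed

end
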